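(* Let $\mathcal{X}\subseteq\{0,1\}^n$ be the feasible set of a combinatorial problem $\mathcal{P}$, let $\pmb{a},\pmb{b}\in\mathbb{R}^n_+$ with $\pmb{a}\le\pmb{b}$, and let the support set be $\Xi=\Xi_{\pmb{a},\pmb{b}}=\{\pmb{\xi}\in\mathbb{R}^n_+:\pmb{a}\le\pmb{\xi}\le\pmb{b}\}$. Let $\hat{\pmb{\xi}}_1,\dots,\hat{\pmb{\xi}}_N\in\Xi$ with $\widehat{\mathbb{P}}^N=(\hat{\pmb{\xi}}_1,\dots,\hat{\pmb{\xi}}_N)$, let $\epsilon\ge0$, $q\in[1,\infty]$, and let $\alpha\in(\frac{l-1}N,\frac lN]$ for some $l\in\{1,\dots,N\}$. Let $\overline{\pmb{\xi}}$ maximize $\pmb{1}^T\pmb{\xi}$ over $\pmb{\xi}\in\Xi$, where $\pmb{1}=(1,\dots,1)^T$. Let $c\ge1$ be the smallest constant such that $\|\overline{\pmb{\xi}}-\hat{\pmb{\xi}}_i\|_q\le c\,\frac{\epsilon N}{l}$ for $i=1,\dots,N$, and define $\mathbb{P}'^N=(\pmb{\xi}'_1,\dots,\pmb{\xi}'_N)$ by $\pmb{\xi}'_i=\hat{\pmb{\xi}}_i+\frac{\overline{\pmb{\xi}}-\hat{\pmb{\xi}}_i}{c}$. If $\pmb{x}'\in\mathcal{X}$ minimizes ${\rm CVaR}^{\alpha}_{\mathbb{P}'^N}[\tilde{\pmb{\xi}}^T\pmb{x}]$ over $\pmb{x}\in\mathcal{X}$, then $\pmb{x}'$ is a $c$-approximate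 solution to $\textsc{Distr}\ \mathcal{P}$.
   Context: The notation $\mathbb{P}^N=(\pmb{\xi}_1,\dots,\pmb{\xi}_N)$ denotes the discrete distribution $\frac1N\sum_{i=1}^N\delta_{\pmb{\xi}_i}$ (repetitions allowed), $\tilde{\pmb{\xi}}$ is a random vector with the distribution indicated in the subscript, and ${\rm CVaR}^{\alpha}_{\mathbb{P}^N}[\tilde{\pmb{\xi}}^T\pmb{x}]=\inf_{t\in\mathbb{R}}\big(t+\frac1{\alpha N}\sum_{i=1}^N\max\{0,\pmb{\xi}_i^T\pmb{x}-t\}\big)$. The constant $c$ is assumed to exist (this is automatic if $\epsilon>0$). The ambiguity set is $$\mathcal{B}_{\epsilon}(\widehat{\mathbb{P}}^N)=\Big\{(\pmb{\xi}_1,\dots,\pmb{\xi}_N):\ \sum_{i=1}^N\|\pmb{\xi}_i-\hat{\pmb{\xi}}_i\|_q\le N\epsilon,\ \pmb{\xi}_i\in\Xi,\ i=1,\dots,N\Big\}.$$ $\textsc{Distr}\ \mathcal{P}$ is the problem $\min_{\pmb{x}\in\mathcal{X}}F(\pmb{x})$ with $F(\pmb{x})=\max_{\mathbb{P}^N\in\mathcal{B}_\epsilon(\widehat{\mathbb{P}}^N)}{\rm CVaR}^{\alpha}_{\mathbb{P}^N}[\tilde{\pmb{\xi}}^T\pmb{x}]$. A solution $\pmb{x}'\in\mathcal{X}$ is $\rho$-approximate if $F(\pmb{x}')\le\rho\,\min_{\pmb{x}\in\mathcal{X}}F(\pmb{x})$. *)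

theory Defs
  imports "HOL-Analysis.Analysis"
begin

definition lq_norm :: "ereal \<Rightarrow> real ^ 'n \<Rightarrow> real" where
  "lq_norm q v =
     (if q = \<infinity> then infnorm v
      else (\<Sum>i\<in>UNIV. \<bar>v $ i\<bar> powr real_of_ereal q) powr (1 / real_of_ereal q))"

definition support_set :: "real ^ 'n \<Rightarrow> real ^ 'n \<Rightarrow> (real ^ 'n) set" where
  "support_set a b = {\<xi>. 0 \<le> \<xi> \<and> a \<le> \<xi> \<and> \<xi> \<le> b}"

text \<open>
  The uniform discrete distribution on the points \<open>\<xi> 1, \<dots>, \<xi> N\<close> (repetitions allowed) is
  represented by the family \<open>\<xi> :: nat \<Rightarrow> real ^ 'n\<close>; only its values on \<open>{1..N}\<close> matter.
\<close>

definition cvar :: "real \<Rightarrow> nat \<Rightarrow> (nat \<Rightarrow> real ^ 'n) \<Rightarrow> real ^ 'n \<Rightarrow> real" where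
  "cvar \<alpha> N \<xi> x = (INF t. t + 1 / (\<alpha> * real N) * (\<Sum>i=1..N. max 0 (\<xi> i \<bullet> x - t)))"

definition ambiguity_set ::
  "ereal \<Rightarrow> real \<Rightarrow> nat \<Rightarrow> (real ^ 'n) set \<Rightarrow> (nat \<Rightarrow> real ^ 'n) \<Rightarrow> (nat \<Rightarrow> real ^ 'n) set" where
  "ambiguity_set q \<epsilon> N \<Xi> \<xi>hat =
     {\<xi> \<in> {1..N} \<rightarrow>\<^sub>E \<Xi>. (\<Sum>i=1..N. lq_norm q (\<xi> i - \<xi>hat i)) \<le> real N * \<epsilon>}"

text \<open>
  The supremum below is a maximum for compact \<open>\<Xi>\<close> and \<open>0 < \<alpha> \<le> 1\<close>;
  see \<open>robust_cvar_attained\<close>.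
\<close>

definition robust_cvar ::
  "real \<Rightarrow> ereal \<Rightarrow> real \<Rightarrow> nat \<Rightarrow> (real ^ 'n) set \<Rightarrow> (nat \<Rightarrow> real ^ 'n) \<Rightarrow> real ^ 'n \<Rightarrow> real" where
  "robust_cvar \<alpha> q \<epsilon> N \<Xi> \<xi>hat x = (SUP \<xi>\<in>ambiguity_set q \<epsilon> N \<Xi> \<xi>hat. cvar \<alpha> N \<xi> x)"

definition approx_solution ::
  "real \<Rightarrow> real \<Rightarrow> ereal \<Rightarrow> real \<Rightarrow> nat \<Rightarrow> (real ^ 'n) set \<Rightarrow> (nat \<Rightarrow> real ^ 'n) \<Rightarrow>
   (real ^ 'n) set \<Rightarrow> real ^ 'n \<Rightarrow> bool" where
  "approx_solution \<rho> \<alpha> q \<epsilon> N \<Xi> \<xi>hat X x' \<longleftrightarrow>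
     x' \<in> X \<and>
     robust_cvar \<alpha> q \<epsilon> N \<Xi> \<xi>hat x' \<le> \<rho> * Min (robust_cvar \<alpha> q \<epsilon> N \<Xi> \<xi>hat ` X)"

lemma compact_support_set: "compact (support_set a b)"
proof -
  have "support_set a b = cbox a b \<inter> cbox 0 b"
    by (auto simp: support_set_def less_eq_vec_def mem_box_cart)
  then show ?thesis by (simp add: compact_Int)
qed

lemma continuous_on_lq_norm:
  assumes "1 \<le> q"
  shows "continuous_on UNIV (lq_norm q :: real ^ 'n \<Rightarrow> real)"
proof (cases "q = \<infinity>")
  case True
  then have "(lq_norm q :: real ^ 'n \<Rightarrow> real) = infnorm" by (auto simp: lq_norm_def)
  then show ?thesis using continuous_on_infnorm[OF continuous_on_id] by simp
next
  case False
  then obtain p where p: "q = ereal p" "1 \<le> p" using assms by (cases q) auto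
  have "(lq_norm q :: real ^ 'n \<Rightarrow> real) = (\<lambda>v. (\<Sum>i\<in>UNIV. \<bar>v $ i\<bar> powr p) powr (1 / p))"
    using p by (auto simp: lq_norm_def)
  moreover have "continuous_on UNIV (\<lambda>v::real ^ 'n. \<bar>v $ i\<bar> powr p)" for i
    by (rule continuous_on_powr')
      (use p in \<open>auto intro!: continuous_on_rabs continuous_on_component continuous_on_id\<close>)
  then have "continuous_on UNIV (\<lambda>v::real ^ 'n. \<Sum>i\<in>UNIV. \<bar>v $ i\<bar> powr p)"
    by (intro continuous_on_sum)
  then have "continuous_on UNIV (\<lambda>v::real ^ 'n. (\<Sum>i\<in>UNIV. \<bar>v $ i\<bar> powr p) powr (1 / p))"
    by (rule continuous_on_powr') (use p in \<open>auto intro: sum_nonneg\<close>)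
  ultimately show ?thesis by simp
qed

lemma cvar_bdd_below:
  assumes "0 < \<alpha>" "\<alpha> \<le> 1" "N \<ge> 1"
  shows "bdd_below (range (\<lambda>t. t + 1 / (\<alpha> * real N) * (\<Sum>i=1..N. max 0 (\<xi> i \<bullet> x - t))))"
proof -
  define m where "m = Min ((\<lambda>i. \<xi> i \<bullet> x) ` {1..N})"
  have "m \<le> t + 1 / (\<alpha> * real N) * (\<Sum>i=1..N. max 0 (\<xi> i \<bullet> x - t))" for t
  proof (cases "m \<le> t")
    case True
    have "0 \<le> 1 / (\<alpha> * real N) * (\<Sum>i=1..N. max 0 (\<xi> i \<bullet> x - t))"
      using assms by (intro mult_nonneg_nonneg sum_nonneg) auto
    then show ?thesis using True by linarith
  next
    case False
    have "real N * (m - t) = (\<Sum>i=1..N. m - t)" by simp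
    also have "\<dots> \<le> (\<Sum>i=1..N. max 0 (\<xi> i \<bullet> x - t))"
    proof (rule sum_mono)
      fix i assume "i \<in> {1..N}"
      then have "m \<le> \<xi> i \<bullet> x" unfolding m_def by (intro Min_le) auto
      then show "m - t \<le> max 0 (\<xi> i \<bullet> x - t)" by auto
    qed
    finally have *: "real N * (m - t) \<le> (\<Sum>i=1..N. max 0 (\<xi> i \<bullet> x - t))" .
    have "m - t \<le> 1 / \<alpha> * (m - t)"
      using False assms mult_right_mono[of 1 "1 / \<alpha>" "m - t"] by simp
    also have "\<dots> = 1 / (\<alpha> * real N) * (real N * (m - t))"
      using assms by simp
    also have "\<dots> \<le> 1 / (\<alpha> * real N) * (\<Sum>i=1..N. max 0 (\<xi> i \<bullet> x - t))"
      using * assms by (intro mult_left_mono) auto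
    finally show ?thesis by simp
  qed
  then show ?thesis by (auto simp: bdd_below_def)
qed

lemma cvar_le_cvar_plus:
  assumes "0 < \<alpha>" "\<alpha> \<le> 1" "N \<ge> 1"
  shows "cvar \<alpha> N \<xi> x \<le> cvar \<alpha> N \<zeta> x + 1 / (\<alpha> * real N) * (\<Sum>i=1..N. \<bar>(\<xi> i - \<zeta> i) \<bullet> x\<bar>)"
    (is "_ \<le> _ + ?d")
proof -
  have "cvar \<alpha> N \<xi> x - ?d \<le> t + 1 / (\<alpha> * real N) * (\<Sum>i=1..N. max 0 (\<zeta> i \<bullet> x - t))" for t
  proof -
    have "cvar \<alpha> N \<xi> x \<le> t + 1 / (\<alpha> * real N) * (\<Sum>i=1..N. max 0 (\<xi> i \<bullet> x - t))"
      unfolding cvar_def by (intro cINF_lower cvar_bdd_below assms) simp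
    also have "\<dots> \<le> t + 1 / (\<alpha> * real N) *
        (\<Sum>i=1..N. max 0 (\<zeta> i \<bullet> x - t) + \<bar>(\<xi> i - \<zeta> i) \<bullet> x\<bar>)"
      using assms by (intro add_left_mono mult_left_mono sum_mono) (auto simp: inner_diff_left)
    finally show ?thesis by (simp add: sum.distrib distrib_left)
  qed
  then have "cvar \<alpha> N \<xi> x - ?d \<le> cvar \<alpha> N \<zeta> x"
    unfolding cvar_def[of _ _ \<zeta>] by (intro cINF_greatest) auto
  then show ?thesis by simp
qed

lemma continuous_on_cvar:
  fixes x :: "real ^ 'n"
  assumes "0 < \<alpha>" "\<alpha> \<le> 1" "N \<ge> 1"
  shows "continuous_on S (\<lambda>\<xi>. cvar \<alpha> N \<xi> x)"
  unfolding continuous_on_def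
proof
  fix \<zeta> assume "\<zeta> \<in> S"
  let ?d = "\<lambda>\<xi>. 1 / (\<alpha> * real N) * (\<Sum>i=1..N. \<bar>(\<xi> i - \<zeta> i) \<bullet> x\<bar>)"
  have "continuous_on UNIV (\<lambda>\<xi>::nat \<Rightarrow> real ^ 'n. \<xi> i)" for i
    by (rule continuous_on_product_coordinates)
  then have "continuous_on UNIV (\<lambda>\<xi>. \<bar>(\<xi> i - \<zeta> i) \<bullet> x\<bar>)" for i
    by (rule continuous_on_rabs[OF continuous_on_inner[OF continuous_on_diff]])
      (rule continuous_on_const)+
  then have "continuous_on UNIV ?d"
    by (rule continuous_on_mult_left[OF continuous_on_sum])
  then have d: "(?d \<longlongrightarrow> 0) (at \<zeta> within S)"
    using continuous_on_subset[of UNIV ?d S] \<open>\<zeta> \<in> S\<close> by (force simp: continuous_on_def)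
  have "\<bar>cvar \<alpha> N \<xi> x - cvar \<alpha> N \<zeta> x\<bar> \<le> ?d \<xi>" for \<xi>
    using cvar_le_cvar_plus[OF assms, of \<xi> x \<zeta>] cvar_le_cvar_plus[OF assms, of \<zeta> x \<xi>]
    by (simp add: inner_diff_left abs_minus_commute abs_le_iff algebra_simps)
  then have "((\<lambda>\<xi>. cvar \<alpha> N \<xi> x - cvar \<alpha> N \<zeta> x) \<longlongrightarrow> 0) (at \<zeta> within S)"
    by (intro Lim_null_comparison[OF _ d]) auto
  then show "((\<lambda>\<xi>. cvar \<alpha> N \<xi> x) \<longlongrightarrow> cvar \<alpha> N \<zeta> x) (at \<zeta> within S)"
    by (simp add: LIM_zero_iff)
qed

lemma compact_ambiguity_set:
  fixes \<Xi> :: "(real ^ 'n) set"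
  assumes "1 \<le> q" "compact \<Xi>"
  shows "compact (ambiguity_set q \<epsilon> N \<Xi> \<xi>hat)"
proof -
  let ?K = "\<lambda>i. if i \<in> {1..N} then \<Xi> else {undefined}"
  have "compactin (product_topology (\<lambda>i. euclidean) UNIV) (Pi\<^sub>E UNIV ?K)"
    using assms by (subst compactin_PiE) auto
  moreover have "Pi\<^sub>E UNIV ?K = {1..N} \<rightarrow>\<^sub>E \<Xi>"
    by (auto simp: PiE_iff extensional_def split: if_splits)
  ultimately have "compact ({1..N} \<rightarrow>\<^sub>E \<Xi>)"
    by (simp add: euclidean_product_topology)
  moreover have "continuous_on UNIV (\<lambda>\<xi>::nat \<Rightarrow> real ^ 'n. lq_norm q (\<xi> i - \<xi>hat i))" for i
    by (rule continuous_on_compose2[OF continuous_on_lq_norm[OF assms(1)]])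
      (auto intro!: continuous_on_diff continuous_on_product_coordinates)
  then have "continuous_on UNIV (\<lambda>\<xi>::nat \<Rightarrow> real ^ 'n. \<Sum>i=1..N. lq_norm q (\<xi> i - \<xi>hat i))"
    by (intro continuous_on_sum)
  then have "closed {\<xi>. (\<Sum>i=1..N. lq_norm q (\<xi> i - \<xi>hat i)) \<le> real N * \<epsilon>}"
    by (intro closed_Collect_le continuous_on_const)
  ultimately have "compact (({1..N} \<rightarrow>\<^sub>E \<Xi>) \<inter> {\<xi>. (\<Sum>i=1..N. lq_norm q (\<xi> i - \<xi>hat i)) \<le> real N * \<epsilon>})"
    by (rule compact_Int_closed)
  moreover have "ambiguity_set q \<epsilon> N \<Xi> \<xi>hat =
      ({1..N} \<rightarrow>\<^sub>E \<Xi>) \<inter> {\<xi>. (\<Sum>i=1..N. lq_norm q (\<xi> i - \<xi>hat i)) \<le> real N * \<epsilon>}"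
    unfolding ambiguity_set_def by blast
  ultimately show ?thesis by simp
qed

lemma robust_cvar_attained:
  fixes \<Xi> :: "(real ^ 'n) set"
  assumes "0 < \<alpha>" "\<alpha> \<le> 1" "N \<ge> 1" "1 \<le> q" "0 \<le> \<epsilon>" "compact \<Xi>"
    and "\<And>i. i \<in> {1..N} \<Longrightarrow> \<xi>hat i \<in> \<Xi>"
  obtains \<xi> where "\<xi> \<in> ambiguity_set q \<epsilon> N \<Xi> \<xi>hat"
    and "\<And>\<zeta>. \<zeta> \<in> ambiguity_set q \<epsilon> N \<Xi> \<xi>hat \<Longrightarrow> cvar \<alpha> N \<zeta> x \<le> cvar \<alpha> N \<xi> x"
    and "robust_cvar \<alpha> q \<epsilon> N \<Xi> \<xi>hat x = cvar \<alpha> N \<xi> x"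
proof -
  let ?B = "ambiguity_set q \<epsilon> N \<Xi> \<xi>hat"
  have "lq_norm q (0 :: real ^ 'n) = 0" by (simp add: lq_norm_def infnorm_0)
  then have "restrict \<xi>hat {1..N} \<in> ?B"
    using assms by (auto simp: ambiguity_set_def)
  then have "?B \<noteq> {}" by blast
  then obtain \<xi> where \<xi>: "\<xi> \<in> ?B" "\<And>\<zeta>. \<zeta> \<in> ?B \<Longrightarrow> cvar \<alpha> N \<zeta> x \<le> cvar \<alpha> N \<xi> x"
    using continuous_attains_sup[OF compact_ambiguity_set[OF assms(4,6)] _
        continuous_on_cvar[OF assms(1-3)]] by blast
  moreover have "robust_cvar \<alpha> q \<epsilon> N \<Xi> \<xi>hat x = cvar \<alpha> N \<xi> x"
    unfolding robust_cvar_def using \<xi> by (intro cSup_eq_maximum) auto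
  ultimately show thesis by (rule that)
qed

end

theory Submission
  imports Defs
begin

text \<open>
  Every point of \<open>\<Xi>\<close> lies below the maximizer \<open>\<xi>bar\<close>, and \<open>\<xi>bar \<le> c \<xi>'\<^sub>i\<close> since \<open>\<xi>hat\<^sub>i \<ge> 0\<close> and
  \<open>c \<ge> 1\<close>; as CVaR is monotone and positively homogeneous, \<open>F x' \<le> c CVaR\<^bsub>\<xi>'\<^esub> x'\<close>.
  Conversely \<open>CVaR\<^bsub>\<xi>'\<^esub> x \<le> F x\<close> for every \<open>x\<close>: because \<open>\<alpha> N \<le> l\<close>, the CVaR depends only on the \<open>l\<close> largest
  scenarios, so it is unchanged when all other \<open>\<xi>'\<^sub>i\<close> are moved back to \<open>\<xi>hat\<^sub>i\<close>, and moving only \<open>l\<close>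
  scenarios costs at most \<open>l \<cdot> \<epsilon> N / l\<close>.
\<close>

lemma lq_norm_scaleR:
  assumes "1 \<le> q" "0 \<le> s"
  shows "lq_norm q (s *\<^sub>R v) = s * lq_norm q v"
proof (cases "q = \<infinity>")
  case True
  then show ?thesis using assms by (simp add: lq_norm_def infnorm_mul)
next
  case False
  then obtain p where p: "q = ereal p" "1 \<le> p" using assms by (cases q) auto
  have "(\<Sum>i\<in>UNIV. \<bar>(s *\<^sub>R v) $ i\<bar> powr p) = s powr p * (\<Sum>i\<in>UNIV. \<bar>v $ i\<bar> powr p)"
    using assms by (simp add: abs_mult powr_mult sum_distrib_left)
  then show ?thesis
    using p assms by (simp add: lq_norm_def powr_mult sum_nonneg powr_powr)
qed

lemma cvar_le:
  assumes "0 < \<alpha>" "\<alpha> \<le> 1" "N \<ge> 1"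
  shows "cvar \<alpha> N \<xi> x \<le> t + 1 / (\<alpha> * real N) * (\<Sum>i=1..N. max 0 (\<xi> i \<bullet> x - t))"
  unfolding cvar_def by (intro cINF_lower cvar_bdd_below assms) simp

text \<open>Monotonicity and positive homogeneity in one inequality. Substituting
  \<open>c * t\<close> for the threshold turns the objective for \<open>\<xi>\<close> into at most
  \<open>c\<close> times the objective for \<open>\<zeta>\<close> at \<open>t\<close>; the infimum
  over \<open>t\<close> follows.\<close>

lemma cvar_mono_scale:
  assumes "0 < \<alpha>" "\<alpha> \<le> 1" "N \<ge> 1" and "0 < c"
    and le: "\<And>i. i \<in> {1..N} \<Longrightarrow> \<xi> i \<bullet> x \<le> c * (\<zeta> i \<bullet> x)"
  shows "cvar \<alpha> N \<xi> x \<le> c * cvar \<alpha> N \<zeta> x"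
proof -
  have "cvar \<alpha> N \<xi> x / c \<le> t + 1 / (\<alpha> * real N) * (\<Sum>i=1..N. max 0 (\<zeta> i \<bullet> x - t))" for t
  proof -
    have "max 0 (\<xi> i \<bullet> x - c * t) \<le> c * max 0 (\<zeta> i \<bullet> x - t)" if "i \<in> {1..N}" for i
    proof -
      have "\<xi> i \<bullet> x - c * t \<le> c * (\<zeta> i \<bullet> x - t)"
        using le[OF that] by (simp add: algebra_simps)
      also have "\<dots> \<le> c * max 0 (\<zeta> i \<bullet> x - t)"
        using \<open>0 < c\<close> by (intro mult_left_mono) auto
      finally show ?thesis using \<open>0 < c\<close> by simp
    qed
    then have "(\<Sum>i=1..N. max 0 (\<xi> i \<bullet> x - c * t)) \<le> c * (\<Sum>i=1..N. max 0 (\<zeta> i \<bullet> x - t))"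
      unfolding sum_distrib_left by (rule sum_mono)
    then have "1 / (\<alpha> * real N) * (\<Sum>i=1..N. max 0 (\<xi> i \<bullet> x - c * t))
        \<le> 1 / (\<alpha> * real N) * (c * (\<Sum>i=1..N. max 0 (\<zeta> i \<bullet> x - t)))"
      using assms by (intro mult_left_mono) auto
    then have "cvar \<alpha> N \<xi> x
        \<le> c * (t + 1 / (\<alpha> * real N) * (\<Sum>i=1..N. max 0 (\<zeta> i \<bullet> x - t)))"
      using cvar_le[OF assms(1-3), of \<xi> x "c * t"] by (simp add: algebra_simps)
    then show ?thesis using \<open>0 < c\<close> by (simp add: pos_divide_le_eq mult.commute)
  qed
  then have "cvar \<alpha> N \<xi> x / c \<le> cvar \<alpha> N \<zeta> x"
    unfolding cvar_def[of _ _ \<zeta>] by (intro cINF_greatest) auto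
  then show ?thesis using \<open>0 < c\<close> by (simp add: pos_divide_le_eq mult.commute)
qed

text \<open>Greedy choice: each step adds a maximizer of \<open>v\<close> on what is left, which
  dominates the rest and is dominated by the elements chosen before. Ties are broken
  arbitrarily.\<close>

lemma obtain_top_subset:
  fixes v :: "'a \<Rightarrow> 'b::linorder"
  assumes "finite A" "l \<le> card A"
  obtains S where "S \<subseteq> A" "card S = l" "\<And>i j. i \<in> S \<Longrightarrow> j \<in> A - S \<Longrightarrow> v j \<le> v i"
proof -
  have "\<exists>S\<subseteq>A. card S = l \<and> (\<forall>i\<in>S. \<forall>j\<in>A - S. v j \<le> v i)"
    using assms(2)
  proof (induction l)
    case 0
    then show ?case by (intro exI[of _ "{}"]) auto
  next
    case (Suc l)
    then obtain S where S: "S \<subseteq> A" "card S = l" "\<forall>i\<in>S. \<forall>j\<in>A - S. v j \<le> v i" by auto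
    have "A - S \<noteq> {}" using S Suc.prems by force
    then have "Max (v ` (A - S)) \<in> v ` (A - S)" using assms(1) by (intro Max_in) auto
    then obtain k where k: "k \<in> A - S" "Max (v ` (A - S)) = v k" by auto
    have "v j \<le> v k" if "j \<in> A - S" for j
      unfolding k(2)[symmetric] using that assms(1) by (intro Max_ge) auto
    moreover have "card (insert k S) = Suc l"
      using k S finite_subset[OF S(1) assms(1)] by simp
    ultimately show ?case using S k by (intro exI[of _ "insert k S"]) auto
  qed
  then show thesis using that by blast
qed

text \<open>With at least \<open>\<alpha> * real N\<close> scenarios in \<open>S\<close>, the
  objective does not increase in \<open>t\<close> up to the smallest value \<open>m\<close> on
  \<open>S\<close>. Beyond \<open>m\<close> only scenarios in \<open>S\<close> have positive excess,
  and in the objective for \<open>\<zeta>\<close> the other scenarios add nonnegative terms.\<close>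

lemma cvar_le_cvar_of_top:
  fixes \<xi> \<zeta> :: "nat \<Rightarrow> real ^ 'n"
  assumes "0 < \<alpha>" "\<alpha> \<le> 1" "N \<ge> 1"
    and S: "S \<subseteq> {1..N}" "S \<noteq> {}" "\<alpha> * real N \<le> real (card S)"
    and top: "\<And>i j. i \<in> S \<Longrightarrow> j \<in> {1..N} - S \<Longrightarrow> \<xi> j \<bullet> x \<le> \<xi> i \<bullet> x"
    and eq: "\<And>i. i \<in> S \<Longrightarrow> \<zeta> i = \<xi> i"
  shows "cvar \<alpha> N \<xi> x \<le> cvar \<alpha> N \<zeta> x"
proof -
  define m where "m = Min ((\<lambda>i. \<xi> i \<bullet> x) ` S)"
  have fin: "finite S" using S by (auto intro: finite_subset)
  have m_le: "m \<le> \<xi> i \<bullet> x" if "i \<in> S" for i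
    unfolding m_def using that fin by (intro Min_le) auto
  have "m \<in> (\<lambda>i. \<xi> i \<bullet> x) ` S"
    unfolding m_def using fin S by (intro Min_in) auto
  then have le_m: "\<xi> j \<bullet> x \<le> m" if "j \<in> {1..N} - S" for j
    using top that by auto
  define w where "w = 1 / (\<alpha> * real N)"
  have w: "0 \<le> w" "1 \<le> w * real (card S)"
    using assms by (auto simp: w_def field_simps)
  have restrict: "(\<Sum>i=1..N. max 0 (\<xi> i \<bullet> x - s)) = (\<Sum>i\<in>S. max 0 (\<xi> i \<bullet> x - s))"
    if "m \<le> s" for s
  proof (rule sum.mono_neutral_right)
    show "\<forall>j\<in>{1..N} - S. max 0 (\<xi> j \<bullet> x - s) = 0"
    proof
      fix j assume "j \<in> {1..N} - S"
      then have "\<xi> j \<bullet> x \<le> s" using le_m that order_trans by blast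
      then show "max 0 (\<xi> j \<bullet> x - s) = 0" by simp
    qed
  qed (use S in auto)
  have "cvar \<alpha> N \<xi> x \<le> t + w * (\<Sum>i=1..N. max 0 (\<zeta> i \<bullet> x - t))" for t
  proof -
    \<comment> \<open>Thresholds below \<open>m\<close> are raised to \<open>m\<close>, so that
      \<open>restrict\<close> applies at \<open>s\<close>; for \<open>t\<close> above
      \<open>m\<close> nothing changes.\<close>
    define s where "s = max m t"
    have le1: "cvar \<alpha> N \<xi> x \<le> s + w * (\<Sum>i\<in>S. max 0 (\<xi> i \<bullet> x - s))"
      using cvar_le[OF assms(1-3), of \<xi> x s] restrict[of s] by (simp add: s_def w_def)
    \<comment> \<open>Below \<open>m\<close> the objective has slope at most \<open>1 - card S / (\<alpha> N) \<le> 0\<close> in \<open>t\<close>.\<close>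
    have "max 0 (\<xi> i \<bullet> x - t) = max 0 (\<xi> i \<bullet> x - s) + (s - t)" if "i \<in> S" for i
      using m_le[OF that] by (auto simp: s_def)
    then have sums: "(\<Sum>i\<in>S. max 0 (\<xi> i \<bullet> x - t))
        = (\<Sum>i\<in>S. max 0 (\<xi> i \<bullet> x - s)) + real (card S) * (s - t)"
      by (simp add: sum.distrib)
    have "s - t \<le> (w * real (card S)) * (s - t)"
      using mult_right_mono[OF w(2), of "s - t"] by (simp add: s_def)
    then have le2: "s + w * (\<Sum>i\<in>S. max 0 (\<xi> i \<bullet> x - s)) \<le> t + w * (\<Sum>i\<in>S. max 0 (\<xi> i \<bullet> x - t))"
      unfolding sums by (simp add: algebra_simps)
    have "(\<Sum>i\<in>S. max 0 (\<xi> i \<bullet> x - t)) = (\<Sum>i\<in>S. max 0 (\<zeta> i \<bullet> x - t))"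
      using eq by simp
    also have "\<dots> \<le> (\<Sum>i=1..N. max 0 (\<zeta> i \<bullet> x - t))"
      using S by (intro sum_mono2) auto
    finally have "w * (\<Sum>i\<in>S. max 0 (\<xi> i \<bullet> x - t)) \<le> w * (\<Sum>i=1..N. max 0 (\<zeta> i \<bullet> x - t))"
      using w(1) by (rule mult_left_mono)
    then show ?thesis using le1 le2 by linarith
  qed
  then show ?thesis
    unfolding cvar_def[of _ _ \<zeta>] w_def by (intro cINF_greatest) auto
qed

text \<open>The corner \<open>b\<close> is itself feasible and dominates the box, so the nonnegative
  gaps \<open>b $ j - \<xi>bar $ j\<close> have sum at most zero and all vanish.\<close>

lemma arg_max_support_set_upper:
  fixes a b \<xi>bar :: "real ^ 'n"
  assumes "0 \<le> b" "a \<le> b"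
    and max: "is_arg_max (\<lambda>\<xi>. 1 \<bullet> \<xi>) (\<lambda>\<xi>. \<xi> \<in> support_set a b) \<xi>bar"
  shows "\<xi>bar = b"
proof -
  have mem: "\<xi>bar \<in> support_set a b" and ge: "1 \<bullet> b \<le> 1 \<bullet> \<xi>bar"
    using max assms by (auto simp: is_arg_max_def support_set_def not_less)
  have nonneg: "0 \<le> b $ j - \<xi>bar $ j" for j
    using mem by (simp add: support_set_def less_eq_vec_def)
  have "(\<Sum>j\<in>UNIV. b $ j - \<xi>bar $ j) \<le> 0"
    using ge by (simp add: inner_vec_def sum_subtractf)
  then have "(\<Sum>j\<in>UNIV. b $ j - \<xi>bar $ j) = 0"
    using nonneg by (simp add: antisym sum_nonneg)
  then have "\<forall>j. b $ j - \<xi>bar $ j = 0"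
    using nonneg by (subst (asm) sum_nonneg_eq_0_iff) auto
  then show ?thesis by (simp add: vec_eq_iff)
qed

lemma finite_binary_vectors: "finite {x :: real ^ 'n. \<forall>j. x $ j \<in> {0, 1}}"
proof (rule finite_subset)
  show "{x :: real ^ 'n. \<forall>j. x $ j \<in> {0, 1}} \<subseteq> vec_lambda ` (UNIV \<rightarrow>\<^sub>E {0, 1})"
  proof
    fix x :: "real ^ 'n" assume "x \<in> {x. \<forall>j. x $ j \<in> {0, 1}}"
    then show "x \<in> vec_lambda ` (UNIV \<rightarrow>\<^sub>E {0, 1})"
      by (intro image_eqI[of _ _ "vec_nth x"]) auto
  qed
qed (simp add: finite_PiE)

lemma inner_vec_mono_left:
  fixes x y z :: "real ^ 'n"
  assumes "x \<le> y" "0 \<le> z"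
  shows "x \<bullet> z \<le> y \<bullet> z"
  using assms by (auto simp: inner_vec_def less_eq_vec_def intro!: sum_mono mult_right_mono)

theorem theorem5:
  fixes X :: "(real ^ 'n) set"
    and a b \<xi>bar x' :: "real ^ 'n"
    and \<xi>hat \<xi>' :: "nat \<Rightarrow> real ^ 'n"
    and N l :: nat and \<epsilon> \<alpha> c :: real and q :: ereal
  assumes "X \<subseteq> {x. \<forall>j. x $ j \<in> {0, 1}}"
    and "0 \<le> a" and "0 \<le> b" and "a \<le> b"
    and "\<And>i. i \<in> {1..N} \<Longrightarrow> \<xi>hat i \<in> support_set a b"
    and "0 \<le> \<epsilon>" and "1 \<le> q"
    and "l \<in> {1..N}" and "\<alpha> \<in> {(real l - 1) / real N <.. real l / real N}"
    and "is_arg_max (\<lambda>\<xi>. 1 \<bullet> \<xi>) (\<lambda>\<xi>. \<xi> \<in> support_set a b) \<xi>bar"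
    and "1 \<le> c"
    and "\<forall>i\<in>{1..N}. lq_norm q (\<xi>bar - \<xi>hat i) \<le> c * (\<epsilon> * real N / real l)"
    and "\<And>d. 1 \<le> d \<Longrightarrow>
           \<forall>i\<in>{1..N}. lq_norm q (\<xi>bar - \<xi>hat i) \<le> d * (\<epsilon> * real N / real l) \<Longrightarrow> c \<le> d"
    and "\<And>i. i \<in> {1..N} \<Longrightarrow> \<xi>' i = \<xi>hat i + (1 / c) *\<^sub>R (\<xi>bar - \<xi>hat i)"
    and "is_arg_min (\<lambda>x. cvar \<alpha> N \<xi>' x) (\<lambda>x. x \<in> X) x'"
  shows "approx_solution c \<alpha> q \<epsilon> N (support_set a b) \<xi>hat X x'"
proof -
  note binary = assms(1) and hat = assms(5) and bound = assms(12) and xi' = assms(14)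
  let ?F = "robust_cvar \<alpha> q \<epsilon> N (support_set a b) \<xi>hat"
  let ?B = "ambiguity_set q \<epsilon> N (support_set a b) \<xi>hat"
  have l: "1 \<le> l" "l \<le> N" and N: "N \<ge> 1" using assms(8) by auto
  \<comment> \<open>The interval for \<open>\<alpha>\<close> is open on the left, so
    \<open>\<alpha>\<close> is positive even for \<open>l = 1\<close>.\<close>
  have "0 \<le> (real l - 1) / real N" "real l / real N \<le> 1" using l by auto
  then have \<alpha>: "0 < \<alpha>" "\<alpha> \<le> 1" using assms(9) by auto
  have \<alpha>_le: "\<alpha> * real N \<le> real l" using assms(9) N by (simp add: field_simps)
  have c: "0 < c" "0 \<le> 1 / c" "1 / c \<le> 1" using \<open>1 \<le> c\<close> by auto
  have bar: "\<xi>bar = b" by (rule arg_max_support_set_upper[OF assms(3,4,10)])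
  have x': "x' \<in> X" and min: "\<And>x. x \<in> X \<Longrightarrow> cvar \<alpha> N \<xi>' x' \<le> cvar \<alpha> N \<xi>' x"
    using assms(15) by (auto simp: is_arg_min_def not_less)
  have X_nonneg: "0 \<le> x" if "x \<in> X" for x
  proof -
    have "0 \<le> x $ j" for j
    proof -
      have "x $ j \<in> {0, 1}" using binary that by blast
      then show ?thesis by auto
    qed
    then show ?thesis by (simp add: less_eq_vec_def)
  qed
  \<comment> \<open>The worst case serves the upper bound, the domination of every member of
    \<open>?B\<close> the lower bound.\<close>
  have attained: "\<exists>\<xi>\<in>?B. ?F x = cvar \<alpha> N \<xi> x \<and> (\<forall>\<zeta>\<in>?B. cvar \<alpha> N \<zeta> x \<le> ?F x)" for x
    by (rule robust_cvar_attained[where \<xi>hat = \<xi>hat and x = x,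
          OF \<alpha> N assms(7,6) compact_support_set hat]) auto

  have upper: "?F x' \<le> c * cvar \<alpha> N \<xi>' x'"
  proof -
    obtain \<xi> where \<xi>: "\<xi> \<in> ?B" "?F x' = cvar \<alpha> N \<xi> x'" using attained by blast
    have "\<xi> i \<bullet> x' \<le> c * (\<xi>' i \<bullet> x')" if i: "i \<in> {1..N}" for i
    proof -
      have "\<xi> i \<le> b" using \<xi>(1) i by (auto simp: ambiguity_set_def support_set_def)
      also have "b \<le> c *\<^sub>R \<xi>' i"
      proof -
        have "0 \<le> \<xi>hat i" using hat[OF i] by (simp add: support_set_def)
        \<comment> \<open>Scaling by \<open>c\<close> undoes the shrinking of the step towards
          \<open>b\<close> and leaves a nonnegative surplus.\<close>
        moreover have "c *\<^sub>R \<xi>' i = b + (c - 1) *\<^sub>R \<xi>hat i"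
          unfolding xi'[OF i] bar using c(1) by (simp add: algebra_simps)
        ultimately show ?thesis using \<open>1 \<le> c\<close> by (simp add: less_eq_vec_def)
      qed
      finally have "\<xi> i \<bullet> x' \<le> (c *\<^sub>R \<xi>' i) \<bullet> x'"
        by (rule inner_vec_mono_left[OF _ X_nonneg[OF x']])
      then show ?thesis by simp
    qed
    then show ?thesis unfolding \<xi>(2) by (intro cvar_mono_scale \<alpha> N c(1))
  qed

  have lower: "cvar \<alpha> N \<xi>' x \<le> ?F x" for x
  proof -
    obtain S where S: "S \<subseteq> {1..N}" "card S = l"
      and top: "\<And>i j. i \<in> S \<Longrightarrow> j \<in> {1..N} - S \<Longrightarrow> \<xi>' j \<bullet> x \<le> \<xi>' i \<bullet> x"
      using obtain_top_subset[of "{1..N}" l "\<lambda>i. \<xi>' i \<bullet> x"] l by auto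
    \<comment> \<open>Only the \<open>l\<close> scenarios that are worst for this particular
      \<open>x\<close> are moved. \<open>restrict\<close> makes the family \<open>undefined\<close>
      outside \<open>{1..N}\<close>, as membership in \<open>?B\<close> demands.\<close>
    define \<zeta> where "\<zeta> = restrict (\<lambda>i. if i \<in> S then \<xi>' i else \<xi>hat i) {1..N}"
    have "\<xi>' i \<in> support_set a b" if i: "i \<in> {1..N}" for i
    proof -
      have "convex (support_set a b)"
      proof -
        have "support_set a b = cbox a b \<inter> cbox 0 b"
          by (auto simp: support_set_def less_eq_vec_def mem_box_cart)
        then show ?thesis by (simp add: convex_Int)
      qed
      moreover have "b \<in> support_set a b" using assms(3,4) by (simp add: support_set_def)
      \<comment> \<open>Since \<open>c\<close> is at least 1, \<open>\<xi>' i\<close> is a convex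
        combination of two points of the box.\<close>
      ultimately have "(1 - 1 / c) *\<^sub>R \<xi>hat i + (1 / c) *\<^sub>R b \<in> support_set a b"
        using hat[OF i] c by (intro convexD) auto
      then show ?thesis unfolding xi'[OF i] bar by (simp add: algebra_simps)
    qed
    then have "\<zeta> \<in> {1..N} \<rightarrow>\<^sub>E support_set a b" using hat by (auto simp: \<zeta>_def)
    moreover have "(\<Sum>i=1..N. lq_norm q (\<zeta> i - \<xi>hat i)) \<le> real N * \<epsilon>"
    proof -
      have "lq_norm q (0 :: real ^ 'n) = 0"
        using lq_norm_scaleR[OF assms(7), of 0 "0 :: real ^ 'n"] by simp
      then have "(\<Sum>i=1..N. lq_norm q (\<zeta> i - \<xi>hat i)) = (\<Sum>i\<in>S. lq_norm q (\<zeta> i - \<xi>hat i))"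
        using S by (intro sum.mono_neutral_right) (auto simp: \<zeta>_def)
      also have "\<dots> \<le> (\<Sum>i\<in>S. \<epsilon> * real N / real l)"
      proof (rule sum_mono)
        fix i assume "i \<in> S"
        then have i: "i \<in> {1..N}" using S by auto
        then have "\<zeta> i - \<xi>hat i = (1 / c) *\<^sub>R (\<xi>bar - \<xi>hat i)"
          using \<open>i \<in> S\<close> xi'[OF i] by (simp add: \<zeta>_def)
        then have "lq_norm q (\<zeta> i - \<xi>hat i) = 1 / c * lq_norm q (\<xi>bar - \<xi>hat i)"
          using lq_norm_scaleR[OF assms(7) c(2)] by simp
        also have "\<dots> \<le> 1 / c * (c * (\<epsilon> * real N / real l))"
          using bound i c(2) by (intro mult_left_mono) auto
        finally show "lq_norm q (\<zeta> i - \<xi>hat i) \<le> \<epsilon> * real N / real l"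
          using c(1) by simp
      qed
      \<comment> \<open>The \<open>l\<close> moves, each of length at most
        \<open>\<epsilon> * real N / real l\<close>, fit the transport budget.\<close>
      also have "\<dots> = real N * \<epsilon>" using S l by simp
      finally show ?thesis .
    qed
    ultimately have "\<zeta> \<in> ?B" by (simp add: ambiguity_set_def)
    moreover have "cvar \<alpha> N \<xi>' x \<le> cvar \<alpha> N \<zeta> x"
    proof (rule cvar_le_cvar_of_top[OF \<alpha> N S(1) _ _ top])
      show "S \<noteq> {}" using S(2) l(1) by auto
      show "\<alpha> * real N \<le> real (card S)" using \<alpha>_le S(2) by simp
      show "\<zeta> i = \<xi>' i" if "i \<in> S" for i using that S(1) by (auto simp: \<zeta>_def)
    qed
    ultimately show ?thesis using attained[of x] order_trans by blast
  qed

  \<comment> \<open>The chain runs from \<open>?F x'\<close> to \<open>c\<close> times the CVaR of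
    \<open>\<xi>'\<close> at \<open>x'\<close>, then by optimality of \<open>x'\<close> to the same
    at \<open>x\<close>, then to \<open>c * ?F x\<close>.\<close>
  have "?F x' \<le> c * ?F x" if "x \<in> X" for x
  proof -
    have "cvar \<alpha> N \<xi>' x' \<le> ?F x" using min[OF that] lower[of x] by linarith
    then show ?thesis using upper c(1) by (meson mult_left_mono less_imp_le order_trans)
  qed
  \<comment> \<open>\<open>X\<close> is finite, being binary, and contains \<open>x'\<close>; hence
    \<open>Min\<close> is the value of \<open>?F\<close> at some point of \<open>X\<close>, where
    the bound just shown applies.\<close>
  moreover have "Min (?F ` X) \<in> ?F ` X"
    using finite_subset[OF binary finite_binary_vectors] x' by (intro Min_in) auto
  ultimately show ?thesis using x' by (auto simp: approx_solution_def)
qed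

end
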